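(* Let $A \in \mathbb{C}^{n\times n}$ be Schur stable, $B\in\mathbb{C}^{n\times m}$, $C\in\mathbb{C}^{l\times n}$, $D\in\mathbb{C}^{l\times m}$, and suppose that $(A,B)$ is controllable. Then strong duality holds between the primal semidefinite program $$\max_{V}\ \operatorname{Tr}\left(\begin{bmatrix} C & D\end{bmatrix} V \begin{bmatrix} C & D\end{bmatrix}^*\right)$$ over Hermitian $V\in\mathbb{C}^{(n+m)\times(n+m)}$ subject to $$\begin{bmatrix} I_n & 0_{n,m}\end{bmatrix} V \begin{bmatrix} I_n \\ 0_{m,n}\end{bmatrix} = \begin{bmatrix} A & B\end{bmatrix} V \begin{bmatrix} A^* \\ B^*\end{bmatrix},\qquad \operatorname{Tr}\left(\begin{bmatrix} 0_{m,n} & I_m\end{bmatrix} V \begin{bmatrix} 0_{m,n} & I_m\end{bmatrix}^*\right)\le 1,\qquad V\succeq 0,$$ and its Lagrangian dual $$\min_{\lambda,P}\ \lambda$$ over $\lambda\in\mathbb{R}$ and $P\in\mathbb{C}^{n\times n}$ subject to $$\begin{bmatrix} A^*PA-P & A^*PB\\ B^*PA & B^*PB\end{bmatrix}+\begin{bmatrix} C^*C & C^*D\\ D^*C & D^*D-\lambda I_m\end{bmatrix}\preceq 0,\qquad \lambda\ge 0,\qquad P=P^*.$$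
   Context: $W^*$ is the conjugate transpose of $W$; $X\succeq 0$ (resp. $X\preceq0$) means $X$ is Hermitian positive (resp. negative) semidefinite; $I_n$ is the $n\times n$ identity and $0_{m,n}$ the $m\times n$ zero matrix; $n,m,l\ge1$. A square matrix is Schur stable if its spectral radius is less than $1$. $(A,B)$ is controllable if $\begin{bmatrix} B & AB & \cdots & A^{n-1}B\end{bmatrix}$ has rank $n$. "Strong duality holds" means that the primal and dual optimal values are equal and the dual optimal value is attained by some dual feasible $(\lambda,P)$. *)

theory Defs
  imports "HOL-Analysis.Analysis"
begin

section \<open>Complex matrices\<close>

definition ctranspose :: "complex^'n^'m \<Rightarrow> complex^'m^'n" where
  "ctranspose W = (\<chi> i j. cnj (W $ j $ i))"

definition hermitian :: "complex^'n^'n \<Rightarrow> bool" where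
  "hermitian X \<longleftrightarrow> ctranspose X = X"

definition quad_form :: "complex^'n^'n \<Rightarrow> complex^'n \<Rightarrow> complex" where
  "quad_form X x = (\<Sum>i\<in>UNIV. cnj (x $ i) * (X *v x) $ i)"

lemma ctranspose_mult:
  "ctranspose (X ** Y) = ctranspose Y ** ctranspose X"
  by (simp add: ctranspose_def matrix_matrix_mult_def vec_eq_iff mult.commute)

lemma ctranspose_ctranspose [simp]: "ctranspose (ctranspose X) = X"
  by (simp add: ctranspose_def vec_eq_iff)

lemma hermitian_congruence: "hermitian X \<Longrightarrow> hermitian (W ** X ** ctranspose W)"
  by (simp add: hermitian_def ctranspose_mult matrix_mul_assoc)

text \<open>
  The quadratic form and the trace of a Hermitian matrix are real. Hence nothing is lost by
  taking real parts below, where such numbers are compared or optimised.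
\<close>

lemma hermitian_quad_form_real:
  assumes "hermitian X"
  shows "Im (quad_form X x) = 0"
proof -
  have X: "cnj (X $ i $ j) = X $ j $ i" for i j
    using assms by (auto simp: hermitian_def ctranspose_def vec_eq_iff)
  have "cnj (quad_form X x) = (\<Sum>i\<in>UNIV. \<Sum>j\<in>UNIV. x $ i * (X $ j $ i * cnj (x $ j)))"
    by (simp add: quad_form_def matrix_vector_mult_def sum_distrib_left X)
  also have "\<dots> = (\<Sum>j\<in>UNIV. \<Sum>i\<in>UNIV. x $ i * (X $ j $ i * cnj (x $ j)))"
    by (rule sum.swap)
  also have "\<dots> = quad_form X x"
    by (simp add: quad_form_def matrix_vector_mult_def sum_distrib_left mult_ac)
  finally show ?thesis
    by (simp add: complex_eq_iff)
qed

lemma hermitian_trace_real: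
  assumes "hermitian X"
  shows "Im (trace X) = 0"
proof -
  have "cnj (X $ i $ i) = X $ i $ i" for i
    using assms by (auto simp: hermitian_def ctranspose_def vec_eq_iff)
  then have "cnj (trace X) = trace X"
    by (simp add: trace_def)
  then show ?thesis
    by (simp add: complex_eq_iff)
qed

definition pos_semidef :: "complex^'n^'n \<Rightarrow> bool" where
  "pos_semidef X \<longleftrightarrow> hermitian X \<and> (\<forall>x. Re (quad_form X x) \<ge> 0)"

definition neg_semidef :: "complex^'n^'n \<Rightarrow> bool" where
  "neg_semidef X \<longleftrightarrow> hermitian X \<and> (\<forall>x. Re (quad_form X x) \<le> 0)"

text \<open>
  Block matrices, with the index set of a concatenation rendered as a sum type:
  \<open>hblock X Y\<close> is \<open>[X Y]\<close>, \<open>vblock X Y\<close> is \<open>X\<close> on top of \<open>Y\<close>,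
  and \<open>block4 X Y Z W\<close> has first block row \<open>[X Y]\<close> and second block row \<open>[Z W]\<close>.
\<close>

definition hblock :: "'a^'n^'l \<Rightarrow> 'a^'m^'l \<Rightarrow> 'a^('n + 'm)^'l" where
  "hblock X Y = (\<chi> i j. case j of Inl a \<Rightarrow> X $ i $ a | Inr b \<Rightarrow> Y $ i $ b)"

definition vblock :: "'a^'l^'n \<Rightarrow> 'a^'l^'m \<Rightarrow> 'a^'l^('n + 'm)" where
  "vblock X Y = (\<chi> i. case i of Inl a \<Rightarrow> X $ a | Inr b \<Rightarrow> Y $ b)"

definition block4 ::
  "'a^'n^'k \<Rightarrow> 'a^'m^'k \<Rightarrow> 'a^'n^'l \<Rightarrow> 'a^'m^'l \<Rightarrow> 'a^('n + 'm)^('k + 'l)" where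
  "block4 X Y Z W = vblock (hblock X Y) (hblock Z W)"

section \<open>Schur stability and controllability\<close>

definition spectrum :: "complex^'n^'n \<Rightarrow> complex set" where
  "spectrum A = {k. \<exists>v. v \<noteq> 0 \<and> A *v v = k *s v}"

text \<open>The spectrum of a complex matrix is finite and nonempty, so the maximum exists.\<close>

definition spectral_radius :: "complex^'n^'n \<Rightarrow> real" where
  "spectral_radius A = Max (cmod ` spectrum A)"

definition schur_stable :: "complex^'n^'n \<Rightarrow> bool" where
  "schur_stable A \<longleftrightarrow> spectral_radius A < 1"

text \<open>
  The columns of \<open>[B, AB, ..., A^(n-1) B]\<close> are indexed by pairs \<open>(k, j)\<close> of a block and a column
  within the block. As there are \<open>n\<close> blocks, \<open>k\<close> ranges over the index type \<open>'n\<close>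
  itself, which \<open>to_nat_on\<close> enumerates bijectively as \<open>0, ..., n-1\<close>. The rank does not depend on
  the order of the columns. The matrix power is written as an iterated product because
  \<open>A ^ k\<close> would be the entrywise power.
\<close>

definition controllability_matrix ::
  "complex^'n^'n \<Rightarrow> complex^'m^'n \<Rightarrow> complex^('n \<times> 'm)^'n" where
  "controllability_matrix A B =
     (\<chi> i kj. ((\<lambda>M. A ** M) ^^ to_nat_on (UNIV :: 'n set) (fst kj)) B $ i $ snd kj)"

lemma block_enumeration:
  "bij_betw (to_nat_on (UNIV :: 'n::finite set)) UNIV {..<CARD('n)}"
  by (rule to_nat_on_finite) simp

definition controllable :: "complex^'n^'n \<Rightarrow> complex^'m^'n \<Rightarrow> bool" where
  "controllable A B \<longleftrightarrow> rank (controllability_matrix A B) = CARD('n)"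

section \<open>The primal and the dual semidefinite program\<close>

definition primal_feasible ::
  "complex^'n^'n \<Rightarrow> complex^'m^'n \<Rightarrow> (complex^('n + 'm)^('n + 'm)) set" where
  "primal_feasible A B = {V. hermitian V \<and>
     hblock (mat 1) 0 ** V ** vblock (mat 1) 0
       = hblock A B ** V ** vblock (ctranspose A) (ctranspose B) \<and>
     Re (trace (hblock (0 :: complex^'n^'m) (mat 1) ** V
                ** ctranspose (hblock (0 :: complex^'n^'m) (mat 1)))) \<le> 1 \<and>
     pos_semidef V}"

definition primal_objective ::
  "complex^'n^'l \<Rightarrow> complex^'m^'l \<Rightarrow> complex^('n + 'm)^('n + 'm) \<Rightarrow> real" where
  "primal_objective C D V = Re (trace (hblock C D ** V ** ctranspose (hblock C D)))"

definition dual_feasible ::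
  "complex^'n^'n \<Rightarrow> complex^'m^'n \<Rightarrow> complex^'n^'l \<Rightarrow> complex^'m^'l
     \<Rightarrow> (real \<times> (complex^'n^'n)) set" where
  "dual_feasible A B C D = {(lam, P).
     neg_semidef
       (block4 (ctranspose A ** P ** A - P) (ctranspose A ** P ** B)
               (ctranspose B ** P ** A)     (ctranspose B ** P ** B)
        + block4 (ctranspose C ** C) (ctranspose C ** D)
                 (ctranspose D ** C) (ctranspose D ** D - mat (complex_of_real lam))) \<and>
     lam \<ge> 0 \<and> P = ctranspose P}"

text \<open>
  Optimal values live in the extended reals: an infeasible or unbounded program has value
  \<open>\<plusminus>\<infinity>\<close> rather than an unspecified real number.
\<close>

definition primal_value ::
  "complex^'n^'n \<Rightarrow> complex^'m^'n \<Rightarrow> complex^'n^'l \<Rightarrow> complex^'m^'l \<Rightarrow> ereal" where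
  "primal_value A B C D = (SUP V\<in>primal_feasible A B. ereal (primal_objective C D V))"

definition dual_value ::
  "complex^'n^'n \<Rightarrow> complex^'m^'n \<Rightarrow> complex^'n^'l \<Rightarrow> complex^'m^'l \<Rightarrow> ereal" where
  "dual_value A B C D = (INF (lam, P)\<in>dual_feasible A B C D. ereal lam)"

definition strong_duality ::
  "complex^'n^'n \<Rightarrow> complex^'m^'n \<Rightarrow> complex^'n^'l \<Rightarrow> complex^'m^'l \<Rightarrow> bool" where
  "strong_duality A B C D \<longleftrightarrow>
     primal_value A B C D = dual_value A B C D \<and>
     (\<exists>(lam, P)\<in>dual_feasible A B C D. ereal lam = dual_value A B C D)"

end

theory Submission
  imports Defs "HOL-Complex_Analysis.Laurent_Convergence"
begin

text \<open>
  The pairing of the dual matrix with \<open>V\<close> is the Lagrangian of the primal program, up to the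
  constant \<open>lam\<close>. Weak duality then holds because a negative and a positive semidefinite matrix
  have a nonpositive inner product (\<open>pos_semidef_inner_nonpos_supported\<close>).

  The dual program is feasible by stability: \<open>A^k\<close> tends to zero, so the Stein equation
  \<open>P - A^* P A = Q\<close> is solvable, and with \<open>Q = C^* C + 1\<close> a large \<open>lam\<close> makes the dual matrix negative
  semidefinite (\<open>dual_feasible_nonempty\<close>). As \<open>V = 0\<close> is primal feasible, the primal value is
  therefore a real number \<open>p\<close>.

  For a dual point of value at most \<open>p\<close>, a hyperplane separates the origin from the convex set of
  constraint values and objective gains that positive semidefinite matrices can reach
  (\<open>primal_separation\<close>). It yields multipliers \<open>Y\<close>, \<open>mu\<close> and \<open>nu\<close> for the equality
  constraint, the power constraint and the objective. If \<open>nu > 0\<close>, then \<open>lam = mu / nu\<close> and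
  \<open>P = Y / nu\<close> are dual feasible with \<open>lam \<le> p\<close>.

  A vertical hyperplane, \<open>nu = 0\<close>, has to be excluded. The usual way is a strictly feasible
  primal point, here built from the controllability Gramian. It is quicker to look at the
  hyperplane itself: \<open>nu = 0\<close> forces \<open>mu = 0\<close>, and \<open>Y\<close> then satisfies
  \<open>(A a + B b)^* Y (A a + B b) \<le> a^* Y a\<close> for all \<open>a\<close> and \<open>b\<close>. Stability makes \<open>Y\<close> positive
  semidefinite, so that \<open>Y A^k B = 0\<close> for all \<open>k\<close>, and controllability gives \<open>Y = 0\<close>
  (\<open>stein_inequality_trivial\<close>), which is impossible for a separating hyperplane.
\<close>

section \<open>Powers of a Schur stable matrix\<close>

(* The dollar sign stands for vector components below, not for coefficients of power series. *)
unbundle no fps_syntax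

definition resolvent_pencil :: "complex^'n^'n \<Rightarrow> complex \<Rightarrow> complex^'n^'n" where
  "resolvent_pencil A z = (\<chi> i j. mat 1 $ i $ j - z * A $ i $ j)"

lemma resolvent_pencil_mult: "resolvent_pencil A z *v x = x - z *s (A *v x)"
proof -
  have "resolvent_pencil A z *v x = (mat 1 - (\<chi> i j. z * A $ i $ j)) *v x"
    by (simp add: resolvent_pencil_def vec_eq_iff matrix_vector_mult_def)
  also have "\<dots> = x - z *s (A *v x)"
    unfolding matrix_vector_mult_diff_rdistrib matrix_vector_mul_lid
    by (simp add: vec_eq_iff matrix_vector_mult_def sum_distrib_left mult.assoc)
  finally show ?thesis .
qed

lemma poly_det:
  fixes M :: "complex poly^'n^'n"
  shows "poly (det M) z = det (\<chi> i j. poly (M $ i $ j) z)"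
  by (simp add: det_def poly_sum poly_prod)

lemma det_one_minus_scaled_eq_0_iff:
  fixes A :: "complex^'n^'n"
  shows "det (resolvent_pencil A z) = 0 \<longleftrightarrow> (\<exists>v. v \<noteq> 0 \<and> z *s (A *v v) = v)"
proof -
  have "det (resolvent_pencil A z) \<noteq> 0 \<longleftrightarrow> inj ((*v) (resolvent_pencil A z))"
    using det_nz_iff_inj_gen[of "(*v) (resolvent_pencil A z)"] by simp
  also have "\<dots> \<longleftrightarrow> (\<forall>v. resolvent_pencil A z *v v = 0 \<longrightarrow> v = 0)"
    by (rule vec.inj_iff_eq_0) 
  finally have 1: "det (resolvent_pencil A z) = 0 \<longleftrightarrow> (\<exists>v. v \<noteq> 0 \<and> resolvent_pencil A z *v v = 0)"
    by blast
  then show ?thesis by (auto simp: resolvent_pencil_mult)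
qed

text \<open>
  The inverses of the nonzero eigenvalues are roots of the polynomial \<open>det (1 - z A)\<close>, whose
  value at \<open>0\<close> is \<open>1\<close>. Finiteness makes the maximum in the spectral radius an upper bound for
  all eigenvalues.
\<close>

lemma finite_spectrum:
  fixes A :: "complex^'n^'n"
  shows "finite (spectrum A)"
proof -
  define q where "q = det (\<chi> i j. [:mat 1 $ i $ j, - (A $ i $ j):])"
  have q: "poly q z = det (resolvent_pencil A z)" for z
    unfolding q_def poly_det by (simp add: resolvent_pencil_def)
  have "poly q 0 = 1"
    by (simp add: q resolvent_pencil_def vec_lambda_eta)
  then have "q \<noteq> 0" by auto
  then have "finite {z. poly q z = 0}"
    by (rule poly_roots_finite)
  moreover have "spectrum A \<subseteq> insert 0 (inverse ` {z. poly q z = 0})"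
  proof
    fix k assume "k \<in> spectrum A"
    then obtain v where v: "v \<noteq> 0" "A *v v = k *s v"
      by (auto simp: spectrum_def)
    show "k \<in> insert 0 (inverse ` {z. poly q z = 0})"
    proof (cases "k = 0")
      case False
      then have "poly q (inverse k) = 0"
        using v by (auto simp: q det_one_minus_scaled_eq_0_iff intro!: exI[of _ v])
      then show ?thesis
        by (auto intro!: image_eqI[of _ _ "inverse k"])
    qed simp
  qed
  ultimately show ?thesis
    by (meson finite_imageI finite_insert finite_subset)
qed

lemma schur_stable_eigenvalue:
  assumes "schur_stable A" and "A *v v = k *s v" and "v \<noteq> 0"
  shows "cmod k < 1"
proof -
  have "k \<in> spectrum A"
    using assms by (auto simp: spectrum_def)
  then have "cmod k \<le> spectral_radius A"
    unfolding spectral_radius_def by (intro Max_ge finite_imageI finite_spectrum imageI)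
  then show ?thesis
    using assms(1) by (simp add: schur_stable_def)
qed

lemma schur_stable_det_nonzero:
  assumes "schur_stable A" and "cmod z \<le> 1"
  shows "det (resolvent_pencil A z) \<noteq> 0"
proof
  assume "det (resolvent_pencil A z) = 0"
  then obtain v where v: "v \<noteq> 0" "z *s (A *v v) = v"
    by (auto simp: det_one_minus_scaled_eq_0_iff)
  then have "z \<noteq> 0" by auto
  have "inverse z *s (z *s (A *v v)) = inverse z *s v"
    using v(2) by simp
  with \<open>z \<noteq> 0\<close> have "A *v v = inverse z *s v"
    by simp
  from schur_stable_eigenvalue[OF assms(1) this v(1)] have "inverse (cmod z) < 1"
    by (simp add: norm_inverse)
  with assms(2) \<open>z \<noteq> 0\<close> show False
    by (simp add: field_simps)
qed

text \<open>
  The solution of \<open>(1 - z A) f(z) = b\<close> given by Cramer's rule is holomorphic wherever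
  \<open>det (1 - z A)\<close> does not vanish, hence on a disc of radius greater than one. Comparing
  coefficients in \<open>f(z) = b + z A f(z)\<close> identifies its Taylor coefficients at \<open>0\<close> as the vectors
  \<open>A^k b\<close>. As the Taylor series converges at \<open>z = 1\<close>, these tend to zero.
\<close>

lemma schur_stable_powers_tendsto_0:
  fixes A :: "complex^'n^'n"
  assumes "schur_stable A"
  shows "(\<lambda>k. ((*v) A ^^ k) b) \<longlonglongrightarrow> 0"
proof -
  define U where "U = {z. det (resolvent_pencil A z) \<noteq> 0}"
  define f where "f i z = det (\<chi> k j. if j = i then b $ k else resolvent_pencil A z $ k $ j)
    / det (resolvent_pencil A z)" for i z
  have det_holo: "(\<lambda>z. det (M z)) holomorphic_on S"
    if "\<And>i j. (\<lambda>z. M z $ i $ j) holomorphic_on S" for M :: "complex \<Rightarrow> complex^'n^'n" and S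
    unfolding det_def using that by (intro holomorphic_intros) auto
  have entry_holo: "(\<lambda>z. resolvent_pencil A z $ i $ j) holomorphic_on S" for i j S
    by (auto simp: resolvent_pencil_def intro!: holomorphic_intros)
  have f_holo: "f i holomorphic_on U" for i
    unfolding f_def
  proof (intro holomorphic_on_divide det_holo entry_holo)
    fix k j
    show "(\<lambda>z. (\<chi> k j. if j = i then b $ k else resolvent_pencil A z $ k $ j) $ k $ j) holomorphic_on U"
      using entry_holo by (cases "j = i") auto
  qed (auto simp: U_def)
  have "open U"
  proof -
    have "continuous_on UNIV (\<lambda>z. det (resolvent_pencil A z))"
      by (intro holomorphic_on_imp_continuous_on det_holo entry_holo)
    then have "open ((\<lambda>z. det (resolvent_pencil A z)) -` (- {0}))"
      by (intro open_vimage) auto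
    then show ?thesis by (simp add: U_def vimage_def)
  qed
  moreover have "cball 0 1 \<subseteq> U"
    using schur_stable_det_nonzero[OF assms] by (auto simp: U_def)
  ultimately obtain e where e: "e > 0" "(\<Union>x\<in>cball 0 1. ball x e) \<subseteq> U"
    using compact_subset_open_imp_ball_epsilon_subset[of "cball 0 1" U] by auto
  have ball: "eball 0 (ereal (1 + e)) \<subseteq> U"
  proof -
    have "z \<in> (\<Union>x\<in>cball 0 1. ball x e)" if "cmod z < 1 + e" for z
    \<comment> \<open>Outside the unit disc, the radial projection of z is within distance e of z.\<close>
    proof (cases "cmod z \<le> 1")
      case False
      have "dist (z / cmod z) z = cmod z - 1"
      proof -
        have "z / cmod z - z = complex_of_real (1 / cmod z - 1) * z"
          by (simp add: field_simps)
        then have "dist (z / cmod z) z = \<bar>1 / cmod z - 1\<bar> * cmod z"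
          unfolding dist_norm by (metis norm_mult norm_of_real)
        with False show ?thesis by (auto simp: abs_if field_simps)
      qed
      with that False show ?thesis
        by (intro UN_I[of "z / cmod z"]) (auto simp: norm_divide)
    next
      case True
      with e(1) show ?thesis
        by (intro UN_I[of z]) auto
    qed
    with e show ?thesis by auto
  qed
  define F where "F i = fps_expansion (f i) 0" for i
  have F: "f i has_fps_expansion F i" for i
    unfolding F_def using \<open>open U\<close> \<open>cball 0 1 \<subseteq> U\<close> f_holo
    by (intro has_fps_expansion_fps_expansion) auto
  have rec: "f i z = b $ i + z * (\<Sum>j\<in>UNIV. A $ i $ j * f j z)" if "z \<in> U" for i z
  proof -
    have "resolvent_pencil A z *v (\<chi> k. f k z) = b"
      using that by (subst cramer) (auto simp: U_def f_def)
    then have "(resolvent_pencil A z *v (\<chi> k. f k z)) $ i = b $ i" by simp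
    moreover have "(resolvent_pencil A z *v (\<chi> k. f k z)) $ i = f i z - z * (\<Sum>j\<in>UNIV. A $ i $ j * f j z)"
      by (simp add: resolvent_pencil_mult) (simp add: matrix_vector_mult_def)
    ultimately show ?thesis by (simp add: algebra_simps)
  qed
  have F_rec: "F i = fps_const (b $ i) + fps_X * (\<Sum>j\<in>UNIV. fps_const (A $ i $ j) * F j)" for i
  proof (rule fps_expansion_unique_complex[OF F])
    have "(\<lambda>z. b $ i + z * (\<Sum>j\<in>UNIV. A $ i $ j * f j z)) has_fps_expansion
        fps_const (b $ i) + fps_X * (\<Sum>j\<in>UNIV. fps_const (A $ i $ j) * F j)"
      by (intro fps_expansion_intros F)
    moreover have "eventually (\<lambda>z. b $ i + z * (\<Sum>j\<in>UNIV. A $ i $ j * f j z) = f i z) (nhds 0)"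
      using \<open>open U\<close> \<open>cball 0 1 \<subseteq> U\<close>
      by (intro eventually_nhds_in_open[THEN eventually_mono, of U]) (auto simp: rec[symmetric])
    ultimately show "f i has_fps_expansion
        fps_const (b $ i) + fps_X * (\<Sum>j\<in>UNIV. fps_const (A $ i $ j) * F j)"
      by (simp cong: has_fps_expansion_cong)
  qed
  have coeff: "fps_nth (F i) k = ((*v) A ^^ k) b $ i" for i k
  proof (induction k arbitrary: i)
    case 0
    show ?case by (subst F_rec) simp
  next
    case (Suc k)
    show ?case
      by (subst F_rec) (simp add: fps_sum_nth Suc matrix_vector_mult_def[of A "((*v) A ^^ k) b"])
  qed
  have "(\<lambda>k. ((*v) A ^^ k) b $ i) \<longlonglongrightarrow> 0" for i
  proof -
    have "(\<lambda>k. fps_nth (F i) k * 1 ^ k) sums f i 1"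
      using F holomorphic_on_subset[OF f_holo ball] e(1)
      by (intro has_fps_expansion_imp_sums_complex[where r = "ereal (1 + e)"]) auto
    from summable_LIMSEQ_zero[OF sums_summable[OF this]] show ?thesis
      by (simp add: coeff)
  qed
  then show ?thesis
    by (intro vec_tendstoI) simp
qed

section \<open>Real inner products of complex matrices and vectors\<close>

text \<open>
  Complex vectors and matrices are treated as real Euclidean spaces. Their inner product is the
  real part of the usual Hermitian one, which is all that the two programs depend on, and it
  makes separation of convex sets and the theory of real linear maps directly applicable.
\<close>

lemma inner_complex_eq_Re: "(a::complex) \<bullet> b = Re (cnj a * b)"
  by (simp add: inner_complex_def)

lemma inner_vec_eq_Re: "(x :: complex^'n) \<bullet> y = Re (\<Sum>i\<in>UNIV. cnj (x $ i) * y $ i)"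
  by (simp add: inner_vec_def inner_complex_eq_Re)

lemma Re_quad_form: "Re (quad_form X x) = x \<bullet> (X *v x)"
  by (simp add: quad_form_def inner_vec_eq_Re)

lemma inner_matrix_eq_trace: "(X :: complex^'n^'m) \<bullet> Y = Re (trace (ctranspose X ** Y))"
proof -
  have "X \<bullet> Y = (\<Sum>i\<in>UNIV. \<Sum>j\<in>UNIV. Re (cnj (X $ i $ j) * Y $ i $ j))"
    by (simp add: inner_vec_def inner_complex_eq_Re)
  also have "\<dots> = (\<Sum>j\<in>UNIV. \<Sum>i\<in>UNIV. Re (cnj (X $ i $ j) * Y $ i $ j))"
    by (rule sum.swap)
  also have "\<dots> = Re (trace (ctranspose X ** Y))"
    by (simp add: trace_def ctranspose_def matrix_matrix_mult_def)
  finally show ?thesis .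
qed

text \<open>
  The adjoint of a congruence is the congruence by the conjugate transpose: this is what turns
  the constraints of the primal program into the matrix inequality of the dual one.
\<close>

lemma inner_congruence:
  fixes W :: "complex^'n^'m"
  shows "X \<bullet> (W ** V ** ctranspose W) = (ctranspose W ** X ** W) \<bullet> V"
  unfolding inner_matrix_eq_trace ctranspose_mult ctranspose_ctranspose
  by (metis matrix_mul_assoc trace_mul_sym)

lemma inner_ctranspose_mult:
  fixes W :: "complex^'n^'m"
  shows "x \<bullet> (ctranspose W *v y) = (W *v x) \<bullet> y"
proof -
  have "(\<Sum>i\<in>UNIV. cnj (x $ i) * (\<Sum>j\<in>UNIV. cnj (W $ j $ i) * y $ j))
     = (\<Sum>i\<in>UNIV. \<Sum>j\<in>UNIV. cnj (x $ i) * cnj (W $ j $ i) * y $ j)"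
    by (simp add: sum_distrib_left mult.assoc)
  also have "\<dots> = (\<Sum>j\<in>UNIV. (\<Sum>i\<in>UNIV. cnj (W $ j $ i) * cnj (x $ i)) * y $ j)"
    unfolding sum_distrib_right by (subst sum.swap) (simp add: mult_ac)
  finally show ?thesis
    by (simp add: inner_vec_eq_Re matrix_vector_mult_def ctranspose_def)
qed

lemma inner_congruence_vector:
  fixes W :: "complex^'n^'m"
  shows "x \<bullet> ((ctranspose W ** X ** W) *v y) = (W *v x) \<bullet> (X *v (W *v y))"
  by (simp add: inner_ctranspose_mult flip: matrix_vector_mul_assoc)

lemma inner_hermitian_mult:
  assumes "hermitian X"
  shows "x \<bullet> (X *v y) = (X *v x) \<bullet> y"
  using inner_ctranspose_mult[of x X y] assms by (simp add: hermitian_def)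

lemma scaleR_mult_vector: "(c *\<^sub>R X) *v x = c *\<^sub>R (X *v (x :: complex^'n))"
  by (simp add: vec_eq_iff matrix_vector_mult_def scaleR_sum_right)

lemma mult_scaleR_vector: "X *v (c *\<^sub>R x) = c *\<^sub>R (X *v (x :: complex^'n))"
  by (simp add: vec_eq_iff matrix_vector_mult_def scaleR_sum_right)

lemma mult_axis: "V *v axis k 1 = column k (V :: complex^'n^'m)"
  by (simp add: vec_eq_iff matrix_vector_mult_def axis_def column_def if_distrib cong: if_cong)

lemma bounded_linear_mult_vector: "bounded_linear ((*v) (X :: complex^'n^'m))"
  by (rule linear_conv_bounded_linear[THEN iffD1], rule linearI)
     (simp_all add: mult_scaleR_vector matrix_vector_right_distrib)

lemma linear_congruence: "linear (\<lambda>X. U ** X ** (W :: complex^'n^'m))"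
proof (rule linearI)
  have "(Y + Z) ** W = Y ** W + Z ** W" for Y Z :: "complex^'m^'k"
    by (simp add: matrix_matrix_mult_def vec_eq_iff sum.distrib distrib_right)
  then show "U ** (X + Y) ** W = U ** X ** W + U ** Y ** W" for X Y
    by (simp add: matrix_add_ldistrib)
qed (simp add: matrix_scalar_ac scalar_matrix_assoc)

lemma ctranspose_add: "ctranspose (X + Y) = ctranspose X + ctranspose Y"
  by (simp add: ctranspose_def vec_eq_iff)
lemma ctranspose_diff: "ctranspose (X - Y) = ctranspose X - ctranspose Y"
  by (simp add: ctranspose_def vec_eq_iff)
lemma ctranspose_minus: "ctranspose (- X) = - ctranspose X"
  by (simp add: ctranspose_def vec_eq_iff)
lemma ctranspose_scaleR: "ctranspose (c *\<^sub>R X) = c *\<^sub>R ctranspose X"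
  by (simp add: ctranspose_def vec_eq_iff)
lemma ctranspose_0: "ctranspose 0 = 0"
  by (simp add: ctranspose_def vec_eq_iff)
lemma ctranspose_mat_1: "ctranspose (mat 1) = mat 1"
  by (simp add: ctranspose_def vec_eq_iff mat_def)

section \<open>The cone of positive semidefinite matrices\<close>

lemma pos_semidef_iff: "pos_semidef X \<longleftrightarrow> hermitian X \<and> (\<forall>x. 0 \<le> x \<bullet> (X *v x))"
  by (simp add: pos_semidef_def Re_quad_form)
lemma neg_semidef_iff: "neg_semidef X \<longleftrightarrow> hermitian X \<and> (\<forall>x. x \<bullet> (X *v x) \<le> 0)"
  by (simp add: neg_semidef_def Re_quad_form)

definition outer :: "complex^'n \<Rightarrow> complex^'n^'n" where
  "outer x = (\<chi> i j. x $ i * cnj (x $ j))"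

lemma hermitian_outer: "hermitian (outer x)"
  by (simp add: hermitian_def ctranspose_def outer_def vec_eq_iff mult.commute)

lemma outer_mult: "outer x *v y = (\<Sum>i\<in>UNIV. cnj (x $ i) * y $ i) *s x"
  by (simp add: vec_eq_iff outer_def matrix_vector_mult_def sum_distrib_left sum_distrib_right mult_ac)

lemma quad_outer: "y \<bullet> (outer x *v y) = (cmod (\<Sum>i\<in>UNIV. cnj (x $ i) * y $ i))\<^sup>2"
proof -
  let ?s = "\<Sum>i\<in>UNIV. cnj (x $ i) * y $ i"
  have "(\<Sum>i\<in>UNIV. cnj (y $ i) * (outer x *v y) $ i) = (\<Sum>i\<in>UNIV. ?s * (cnj (y $ i) * x $ i))"
    by (simp add: outer_mult mult_ac)
  also have "\<dots> = ?s * cnj ?s"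
    by (subst sum_distrib_left[symmetric]) (simp add: mult_ac)
  also have "\<dots> = of_real ((cmod ?s)\<^sup>2)"
    by (rule complex_norm_square[symmetric])
  finally have "(\<Sum>i\<in>UNIV. cnj (y $ i) * (outer x *v y) $ i) = of_real ((cmod ?s)\<^sup>2)" .
  then show ?thesis
    unfolding inner_vec_eq_Re by (simp only: Re_complex_of_real)
qed

lemma pos_semidef_outer: "pos_semidef (outer x)"
  by (simp add: pos_semidef_iff hermitian_outer quad_outer)

lemma inner_outer: "X \<bullet> outer x = x \<bullet> (X *v x)"
proof -
  have "X \<bullet> outer x = (\<Sum>i\<in>UNIV. \<Sum>j\<in>UNIV. Re (cnj (X $ i $ j) * (x $ i * cnj (x $ j))))"
    by (simp add: inner_vec_def inner_complex_eq_Re outer_def)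
  also have "\<dots> = (\<Sum>i\<in>UNIV. \<Sum>j\<in>UNIV. Re (cnj (x $ i) * (X $ i $ j * x $ j)))"
    by (intro sum.cong refl) (simp add: algebra_simps)
  also have "\<dots> = x \<bullet> (X *v x)"
    by (simp add: inner_vec_eq_Re matrix_vector_mult_def sum_distrib_left)
  finally show ?thesis .
qed

lemma pos_semidef_0: "pos_semidef 0"
  by (simp add: pos_semidef_iff hermitian_def ctranspose_0)

lemma pos_semidef_add: "pos_semidef X \<Longrightarrow> pos_semidef Y \<Longrightarrow> pos_semidef (X + Y)"
  by (simp add: pos_semidef_iff hermitian_def ctranspose_add matrix_vector_mult_add_rdistrib inner_add_right)

lemma pos_semidef_scaleR: "pos_semidef X \<Longrightarrow> 0 \<le> c \<Longrightarrow> pos_semidef (c *\<^sub>R X)"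
  by (simp add: pos_semidef_iff hermitian_def ctranspose_scaleR scaleR_mult_vector)

text \<open>
  If \<open>X x\<close> were nonzero, moving from \<open>x\<close> a little in the direction \<open>- X x\<close> would make the
  quadratic form negative, since its first-order change is \<open>- 2 |X x|^2\<close> times the step.
\<close>

lemma pos_semidef_null_vector:
  assumes X: "pos_semidef X" and x: "x \<bullet> (X *v x) = 0"
  shows "X *v x = 0"
proof (rule ccontr)
  assume nz: "X *v x \<noteq> 0"
  define y where "y = X *v x"
  define c where "c = y \<bullet> (X *v y)"
  have q: "0 \<le> 2 * (t * (y \<bullet> y)) + t * t * c" for t
  proof -
    have "0 \<le> (x + t *\<^sub>R y) \<bullet> (X *v (x + t *\<^sub>R y))"
      using X by (simp add: pos_semidef_iff)
    also have "\<dots> = 2 * (t * (y \<bullet> y)) + t * t * c"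
      using x X inner_hermitian_mult[of X x y] unfolding pos_semidef_iff c_def
      by (simp add: matrix_vector_right_distrib mult_scaleR_vector inner_add_left inner_add_right y_def inner_commute algebra_simps)
    finally show ?thesis .
  qed
  have yy: "y \<bullet> y > 0" using nz by (simp add: y_def)
  have "c \<ge> 0" using X by (simp add: pos_semidef_iff c_def)
  \<comment> \<open>A step of this size keeps the second-order term c t^2 below the first-order one.\<close>
  define t where "t = - (y \<bullet> y) / (c + 1)"
  have "t < 0" using yy \<open>c \<ge> 0\<close> by (simp add: t_def field_simps)
  have "t * c = - (y \<bullet> y) * (c / (c + 1))" by (simp add: t_def)
  moreover have "c / (c+1) \<le> 1" using \<open>c \<ge> 0\<close> by simp
  ultimately have "2 * (y \<bullet> y) + t * c > 0"
    using yy by (smt (verit) mult_left_le mult_minus_left)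
  then have "t * (2 * (y \<bullet> y) + t * c) < 0"
    using \<open>t < 0\<close> by (simp add: mult_neg_pos)
  with q[of t] show False by (simp add: algebra_simps)
qed

text \<open>
  The pairing is nonpositive on matrices \<open>x x^*\<close>, so it suffices to write \<open>V\<close> as a sum of such
  matrices. This is Cholesky elimination: if column \<open>k\<close> of \<open>V\<close>, say \<open>v\<close>, is nonzero, then
  \<open>V - v v^* / V k k\<close> is again positive semidefinite, has a zero column \<open>k\<close>, and keeps the zero
  columns of \<open>V\<close>. The induction runs over the set of columns that may be nonzero.
\<close>

lemma pos_semidef_inner_nonpos_supported:
  fixes N V :: "complex^'n^'n"
  assumes "finite S" and "pos_semidef V" and "\<And>i. i \<notin> S \<Longrightarrow> V *v axis i 1 = 0"
    and N: "\<And>x. x \<bullet> (N *v x) \<le> 0"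
  shows "N \<bullet> V \<le> 0"
  using assms(1-3)
proof (induction S arbitrary: V rule: finite_induct)
  case empty
  have "column i V = 0" for i
    using empty(2)[of i] by (simp add: mult_axis)
  then have "V = 0"
    by (simp add: vec_eq_iff column_def)
  then show ?case by simp
next
  case (insert k S)
  define v where "v = V *v axis k 1"
  define d where "d = axis k 1 \<bullet> v"
  have herm: "hermitian V" and psd: "\<And>x. 0 \<le> x \<bullet> (V *v x)"
    using insert.prems by (auto simp: pos_semidef_iff)
  show ?case
  proof (cases "v = 0")
    case True
    with insert show ?thesis by (metis insertE v_def)
  next
    case False
    have "d \<noteq> 0"
      using pos_semidef_null_vector[OF insert.prems(1), of "axis k 1"] False by (auto simp: d_def v_def)
    with psd[of "axis k 1"] have d: "d > 0" by (simp add: d_def v_def)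
    have cv: "cnj (v $ i) = V $ k $ i" for i
      using herm by (auto simp: v_def mult_axis column_def hermitian_def ctranspose_def vec_eq_iff)
    have "Im (v $ k) = 0"
      using arg_cong[OF cv[of k], of Im] by (simp add: v_def mult_axis column_def)
    then have vk: "v $ k = complex_of_real d"
      by (simp add: d_def inner_axis' inner_complex_def complex_eq_iff)
    define V' where "V' = V - (1/d) *\<^sub>R outer v"
    have V'_mult: "V' *v y = V *v y - ((\<Sum>i\<in>UNIV. cnj (v $ i) * y $ i) / d) *s v" for y
    proof -
      have "(1/d) *\<^sub>R (c *s v) = (c / d) *s v" for c
        by (simp add: vec_eq_iff) (simp add: scaleR_conv_of_real divide_inverse)
      then show ?thesis
        by (simp add: V'_def matrix_vector_mult_diff_rdistrib scaleR_mult_vector outer_mult)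
    qed
    have herm': "hermitian V'"
      using herm hermitian_outer[of v]
      by (simp add: hermitian_def V'_def ctranspose_diff ctranspose_scaleR)
    have V'k: "V' *v axis k 1 = 0"
      using d by (simp add: V'_mult axis_def if_distrib vk cong: if_cong)
         (simp add: v_def axis_def)
    have "0 \<le> y \<bullet> (V' *v y)" for y
    proof -
      \<comment> \<open>Completing the square: the form of V' at y is the form of V at y - c e_k.\<close>
      define c where "c = (\<Sum>i\<in>UNIV. cnj (v $ i) * y $ i) / d"
      define z where "z = y - c *s axis k 1"
      have "V' *v y = V *v z"
        by (simp add: V'_mult z_def c_def matrix_vector_mult_diff_distrib vector_scalar_commute flip: v_def)
      moreover have "y \<bullet> (V' *v y) = z \<bullet> (V' *v y)"
        using inner_hermitian_mult[OF herm', of "c *s axis k 1" y] V'k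
        by (simp add: z_def inner_diff_left vector_scalar_commute)
      ultimately show ?thesis using psd[of z] by simp
    qed
    then have "pos_semidef V'" by (simp add: pos_semidef_iff herm')
    moreover have "V' *v axis i 1 = 0" if "i \<notin> S" for i
    proof (cases "i = k")
      case False
      with that insert.prems(2) have Vi: "V *v axis i 1 = 0" by auto
      then have "V $ k $ i = 0" by (auto simp: mult_axis column_def vec_eq_iff)
      then have "cnj (v $ i) = 0" by (simp add: cv)
      with Vi show ?thesis
        by (simp add: V'_mult axis_def if_distrib cong: if_cong)
    qed (simp add: V'k)
    ultimately have "N \<bullet> V' \<le> 0" by (rule insert.IH)
    moreover have "N \<bullet> V = N \<bullet> V' + (1/d) * (v \<bullet> (N *v v))"
      by (simp add: V'_def inner_diff_right inner_outer)
    moreover have "(1/d) * (v \<bullet> (N *v v)) \<le> 0"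
      using d N[of v] by (simp add: mult_nonneg_nonpos divide_nonpos_pos)
    ultimately show ?thesis by simp
  qed
qed

lemma affine_bounded_below_imp_slope_nonneg:
  fixes c d :: real
  assumes "\<And>t. 0 \<le> t \<Longrightarrow> 0 \<le> c + t * d"
  shows "0 \<le> d"
proof (rule ccontr)
  assume "\<not> 0 \<le> d"
  then have "d < 0" by simp
  then have "((\<bar>c\<bar> + 1) / (- d)) * d = - (\<bar>c\<bar> + 1)"
    by simp
  then have "c + ((\<bar>c\<bar> + 1) / (- d)) * d < 0"
    by linarith
  moreover have "0 \<le> (\<bar>c\<bar> + 1) / (- d)"
    using \<open>d < 0\<close> by (intro divide_nonneg_pos) auto
  ultimately show False
    using assms by fastforce
qed

text \<open>
  A linear functional that is bounded above on a cone is nonpositive on it; for the functional given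
  by \<open>N\<close> and the matrices \<open>x x^*\<close> of the cone, this is the sign of the form at \<open>x\<close>.
\<close>

lemma neg_semidef_if_bounded_on_cone:
  assumes "hermitian N" and "\<And>V. pos_semidef V \<Longrightarrow> N \<bullet> V \<le> c"
  shows "neg_semidef N"
proof -
  have "x \<bullet> (N *v x) \<le> 0" for x
  proof -
    have "0 \<le> c + t * - (x \<bullet> (N *v x))" if "0 \<le> t" for t
      using assms(2)[OF pos_semidef_scaleR[OF pos_semidef_outer that], of x]
      by (simp add: inner_outer)
    then have "0 \<le> - (x \<bullet> (N *v x))"
      by (rule affine_bounded_below_imp_slope_nonneg)
    then show ?thesis by simp
  qed
  with assms(1) show ?thesis by (simp add: neg_semidef_iff)
qed

section \<open>Stein equations and inequalities\<close>

text \<open>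
  The linear map \<open>P \<mapsto> P - A^* P A\<close> is injective, because \<open>P = A^* P A\<close> forces
  \<open>P = (A^*)^k P A^k\<close> for all \<open>k\<close> and the right-hand side tends to zero. Hence it is bijective, as
  the space of matrices has finite dimension. It commutes with conjugate transposition, so the
  solution for a Hermitian right-hand side is Hermitian.
\<close>

lemma stein_equation_solvable:
  fixes A Q :: "complex^'n^'n"
  assumes "schur_stable A" and "hermitian Q"
  obtains P where "hermitian P" and "P - ctranspose A ** P ** A = Q"
proof -
  let ?T = "\<lambda>P. P - ctranspose A ** P ** A"
  have lin: "linear ?T"
    by (intro linear_compose_sub linear_ident linear_congruence)
  have inj0: "P = 0" if "?T P = 0" for P
  proof -
    have eq: "ctranspose A ** P ** A = P" using that by simp
    have step: "x \<bullet> (P *v y) = (A *v x) \<bullet> (P *v (A *v y))" for x y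
      using inner_congruence_vector[of x A P y] unfolding eq .
    have iter: "x \<bullet> (P *v y) = (((*v) A ^^ k) x) \<bullet> (P *v (((*v) A ^^ k) y))" for x y k
    proof (induction k)
      case (Suc k)
      then show ?case using step[of "((*v) A ^^ k) x" "((*v) A ^^ k) y"] by simp
    qed simp
    have zero: "x \<bullet> (P *v y) = 0" for x y
    proof -
      have "(\<lambda>k. (((*v) A ^^ k) x) \<bullet> (P *v (((*v) A ^^ k) y))) \<longlonglongrightarrow> 0 \<bullet> (P *v 0)"
        by (intro tendsto_inner bounded_linear.tendsto[OF bounded_linear_mult_vector]
            schur_stable_powers_tendsto_0 assms)
      then have "(\<lambda>k. x \<bullet> (P *v y)) \<longlonglongrightarrow> 0"
        unfolding iter[symmetric] by simp
      then show ?thesis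
        by (simp add: LIMSEQ_const_iff)
    qed
    have "P *v y = 0" for y
      using zero[of "P *v y" y] by simp
    then show ?thesis
      by (simp add: matrix_eq)
  qed
  then have inj: "inj ?T"
    using lin by (simp add: linear_injective_0)
  then have "surj ?T"
    using lin linear_injective_imp_surjective by blast
  then have "Q \<in> range ?T"
    by simp
  then obtain P where P: "?T P = Q"
    by auto
  have "?T (ctranspose P) = ctranspose (?T P)"
    by (simp add: ctranspose_diff ctranspose_mult matrix_mul_assoc)
  also have "\<dots> = ?T P"
    using assms(2) P by (simp add: hermitian_def)
  finally have "ctranspose P = P"
    by (rule injD[OF inj])
  then have "hermitian P"
    by (simp add: hermitian_def)
  with P show thesis using that by blast
qed

text \<open>
  A nonzero row of \<open>X\<close> is a linear relation between the rows of \<open>M\<close>, and a row that occurs in it can be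
  omitted from a spanning set.
\<close>

lemma full_row_rank_mult_eq_0:
  fixes M :: "complex^'m^'n" and X :: "complex^'n^'k"
  assumes "rank M = CARD('n)" and "X ** M = 0"
  shows "X = 0"
proof (rule ccontr)
  assume "X \<noteq> 0"
  then obtain r i where ri: "X $ r $ i \<noteq> 0"
    by (auto simp: vec_eq_iff)
  have rel: "(\<Sum>j\<in>UNIV. X $ r $ j *s row j M) = 0"
    using assms(2) by (simp add: vec_eq_iff matrix_matrix_mult_def row_def)
  let ?R = "(\<lambda>j. row j M) ` (UNIV - {i})"
  have "X $ r $ i *s row i M = - (\<Sum>j\<in>UNIV - {i}. X $ r $ j *s row j M)"
    using rel by (simp add: sum.remove[of UNIV i] eq_neg_iff_add_eq_0)
  moreover have "- (\<Sum>j\<in>UNIV - {i}. X $ r $ j *s row j M) \<in> vec.span ?R"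
    by (intro vec.span_neg vec.span_sum vec.span_scale vec.span_base) auto
  ultimately have "X $ r $ i *s row i M \<in> vec.span ?R"
    by simp
  then have "inverse (X $ r $ i) *s (X $ r $ i *s row i M) \<in> vec.span ?R"
    by (rule vec.span_scale)
  then have i: "row i M \<in> vec.span ?R"
    using ri by simp
  have "row j M \<in> vec.span ?R" for j
    by (cases "j = i") (auto intro: i vec.span_base)
  then have "rows M \<subseteq> vec.span ?R"
    by (auto simp: rows_def)
  then have "vec.dim (rows M) \<le> card ?R"
    by (intro vec.dim_le_card) auto
  also have "\<dots> \<le> card (UNIV - {i})"
    by (rule card_image_le) simp
  also have "\<dots> < CARD('n)"
    by (simp add: card_Diff_singleton)
  finally show False
    using assms(1) by (simp add: row_rank_def_gen)
qed

lemma controllable_annihilator: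
  fixes A Y :: "complex^'n^'n" and B :: "complex^'m^'n"
  assumes "controllable A B" and Y: "\<And>k u. Y *v ((*v) A ^^ k) (B *v u) = 0"
  shows "Y = 0"
proof -
  have pow: "((\<lambda>M. A ** M) ^^ k) B *v u = ((*v) A ^^ k) (B *v u)" for k u
    by (induction k) (simp_all flip: matrix_vector_mul_assoc)
  have "(Y ** ((\<lambda>M. A ** M) ^^ k) B) *v u = 0" for k u
    by (simp add: pow Y flip: matrix_vector_mul_assoc)
  then have "Y ** ((\<lambda>M. A ** M) ^^ k) B = 0" for k
    by (simp add: matrix_eq)
  then have "(\<Sum>l\<in>UNIV. Y $ i $ l * ((\<lambda>M. A ** M) ^^ k) B $ l $ j) = 0" for k i j
    by (simp add: vec_eq_iff matrix_matrix_mult_def)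
  then have "Y ** controllability_matrix A B = 0"
    by (simp add: controllability_matrix_def vec_eq_iff matrix_matrix_mult_def)
  with assms(1) show ?thesis
    unfolding controllable_def by (rule full_row_rank_mult_eq_0)
qed

text \<open>
  This is where stability and controllability act together. With \<open>b = 0\<close>, the form of \<open>Y\<close>
  does not increase along the orbits of \<open>A\<close>, which tend to zero, so it is nonnegative. With \<open>a = 0\<close>, it is
  nonpositive on the range of \<open>B\<close>. So it vanishes on the vectors \<open>A^k B u\<close>; as \<open>Y\<close> is positive
  semidefinite, it annihilates them, and controllability says that they span the space.
\<close>

lemma stein_inequality_trivial:
  fixes A Y :: "complex^'n^'n" and B :: "complex^'m^'n"
  assumes "schur_stable A" and "controllable A B" and Y: "hermitian Y"
    and le: "\<And>a b. (A *v a + B *v b) \<bullet> (Y *v (A *v a + B *v b)) \<le> a \<bullet> (Y *v a)"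
  shows "Y = 0"
proof -
  define q where "q a = a \<bullet> (Y *v a)" for a
  have decr: "q (((*v) A ^^ k) a) \<le> q a" for a k
  proof (induction k)
    case (Suc k)
    then show ?case using le[of "((*v) A ^^ k) a" 0] by (simp add: q_def)
  qed simp
  have nonneg: "0 \<le> q a" for a
  proof -
    have "(\<lambda>k. q (((*v) A ^^ k) a)) \<longlonglongrightarrow> 0 \<bullet> (Y *v 0)"
      unfolding q_def
      by (intro tendsto_inner bounded_linear.tendsto[OF bounded_linear_mult_vector]
          schur_stable_powers_tendsto_0 assms)
    then have "(\<lambda>k. q (((*v) A ^^ k) a)) \<longlonglongrightarrow> 0" by simp
    then show ?thesis
      by (rule LIMSEQ_le_const2) (use decr in blast)
  qed
  then have psd: "pos_semidef Y"
    using Y by (simp add: pos_semidef_iff q_def)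
  have "q (((*v) A ^^ k) (B *v u)) = 0" for k u
    using decr[of k "B *v u"] nonneg[of "((*v) A ^^ k) (B *v u)"] le[of 0 u] by (simp add: q_def)
  then have "Y *v ((*v) A ^^ k) (B *v u) = 0" for k u
    using pos_semidef_null_vector[OF psd] by (simp add: q_def)
  with assms(2) show ?thesis
    by (rule controllable_annihilator)
qed

section \<open>The two programs in terms of congruences\<close>

definition vjoin :: "complex^'n \<Rightarrow> complex^'m \<Rightarrow> complex^('n + 'm)" where
  "vjoin a b = (\<chi> i. case i of Inl k \<Rightarrow> a $ k | Inr k \<Rightarrow> b $ k)"

lemma vjoin_cases:
  obtains a b where "x = vjoin a b"
proof
  show "x = vjoin (\<chi> k. x $ Inl k) (\<chi> k. x $ Inr k)"
    by (simp add: vjoin_def vec_eq_iff split: sum.split)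
qed

lemma sum_UNIV_Plus:
  fixes f :: "'x::finite + 'y::finite \<Rightarrow> complex"
  shows "(\<Sum>j\<in>UNIV. f j) = (\<Sum>j\<in>UNIV. f (Inl j)) + (\<Sum>j\<in>UNIV. f (Inr j))"
  using sum.Plus[of UNIV UNIV f] by (simp add: o_def)

lemma hblock_mult_vjoin: "hblock X Y *v vjoin a b = X *v a + Y *v b"
  by (simp add: vec_eq_iff matrix_vector_mult_def hblock_def vjoin_def sum_UNIV_Plus)

lemma ctranspose_hblock: "ctranspose (hblock X Y) = vblock (ctranspose X) (ctranspose Y)"
  by (simp add: vec_eq_iff ctranspose_def hblock_def vblock_def split: sum.split)

lemma vblock_mult: "vblock X Y ** Z = vblock (X ** Z) (Y ** Z)"
  by (simp add: vec_eq_iff matrix_matrix_mult_def vblock_def split: sum.split)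

lemma mult_hblock: "Z ** hblock X Y = hblock (Z ** X) (Z ** Y)"
  by (simp add: vec_eq_iff matrix_matrix_mult_def hblock_def split: sum.split)

lemma vblock_mult_hblock:
  "vblock X Y ** hblock Z W = block4 (X ** Z) (X ** W) (Y ** Z) (Y ** W)"
  by (simp only: vblock_mult) (simp only: mult_hblock block4_def)

lemma block4_add: "block4 X Y Z W + block4 X' Y' Z' W' = block4 (X + X') (Y + Y') (Z + Z') (W + W')"
  by (simp add: vec_eq_iff block4_def hblock_def vblock_def split: sum.split)
lemma block4_diff: "block4 X Y Z W - block4 X' Y' Z' W' = block4 (X - X') (Y - Y') (Z - Z') (W - W')"
  by (simp add: vec_eq_iff block4_def hblock_def vblock_def split: sum.split)
lemma block4_scaleR: "c *\<^sub>R block4 X Y Z W = block4 (c *\<^sub>R X) (c *\<^sub>R Y) (c *\<^sub>R Z) (c *\<^sub>R W)"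
  by (simp add: vec_eq_iff block4_def hblock_def vblock_def split: sum.split)

definition state_block :: "complex^('n::finite + 'm::finite)^'n" where
  "state_block = hblock (mat 1) 0"
definition input_block :: "complex^('n::finite + 'm::finite)^'m" where
  "input_block = hblock 0 (mat 1)"

lemma state_block_vjoin: "state_block *v vjoin a b = a"
  by (simp add: state_block_def hblock_mult_vjoin)
lemma input_block_vjoin: "input_block *v vjoin a b = b"
  by (simp add: input_block_def hblock_mult_vjoin)

definition stein_defect :: "complex^'n^'n \<Rightarrow> complex^'m^'n \<Rightarrow> complex^('n+'m)^('n+'m) \<Rightarrow> complex^'n^'n" where
  "stein_defect A B V = state_block ** V ** ctranspose state_block
     - hblock A B ** V ** ctranspose (hblock A B)"

definition input_power :: "complex^('n::finite+'m::finite)^('n+'m) \<Rightarrow> real" where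
  "input_power V = Re (trace (input_block ** V ** ctranspose (input_block :: complex^('n+'m)^'m)))"

text \<open>
  The matrix that the dual program requires to be negative semidefinite, as a combination of
  congruences. The factor \<open>mat 1\<close> gives all four terms the form covered by the adjoint identity
  for congruences.
\<close>

definition dual_lmi ::
  "complex^'n^'n \<Rightarrow> complex^'m^'n \<Rightarrow> complex^'n^'l \<Rightarrow> complex^'m^'l
     \<Rightarrow> real \<Rightarrow> complex^'n^'n \<Rightarrow> complex^('n+'m)^('n+'m)" where
  "dual_lmi A B C D lam P =
     ctranspose (hblock A B) ** P ** hblock A B - ctranspose state_block ** P ** state_block
     + ctranspose (hblock C D) ** mat 1 ** hblock C D
     - lam *\<^sub>R (ctranspose input_block ** mat 1 ** input_block)"

lemma primal_feasible_iff:
  "V \<in> primal_feasible A B \<longleftrightarrow> pos_semidef V \<and> stein_defect A B V = 0 \<and> input_power V \<le> 1"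
  by (auto simp: primal_feasible_def stein_defect_def input_power_def pos_semidef_iff
      ctranspose_hblock ctranspose_mat_1 ctranspose_0 state_block_def input_block_def)

lemma mat_of_real: "mat (complex_of_real c) = c *\<^sub>R mat 1"
  by (simp add: vec_eq_iff mat_def) (simp add: scaleR_conv_of_real)

lemma dual_lmi_eq_block4:
  "dual_lmi A B C D lam P =
     block4 (ctranspose A ** P ** A - P) (ctranspose A ** P ** B)
            (ctranspose B ** P ** A)     (ctranspose B ** P ** B)
     + block4 (ctranspose C ** C) (ctranspose C ** D)
              (ctranspose D ** C) (ctranspose D ** D - mat (complex_of_real lam))"
  unfolding dual_lmi_def state_block_def input_block_def ctranspose_hblock ctranspose_mat_1
    ctranspose_0 vblock_mult[where Z = P] matrix_mul_rid vblock_mult_hblock mat_of_real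
  by (simp add: block4_add block4_diff block4_scaleR add_diff_eq)

lemma dual_feasible_iff:
  "(lam, P) \<in> dual_feasible A B C D \<longleftrightarrow> neg_semidef (dual_lmi A B C D lam P) \<and> 0 \<le> lam \<and> hermitian P"
  by (auto simp: dual_feasible_def dual_lmi_eq_block4 hermitian_def)

lemma hermitian_dual_lmi:
  assumes "hermitian P"
  shows "hermitian (dual_lmi A B C D lam P)"
  using assms
  by (simp add: hermitian_def dual_lmi_def ctranspose_add ctranspose_diff ctranspose_scaleR
      ctranspose_mult ctranspose_mat_1 matrix_mul_assoc)

lemma Re_trace_eq_inner: "Re (trace X) = mat 1 \<bullet> (X :: complex^'k^'k)"
  by (simp add: inner_matrix_eq_trace ctranspose_mat_1)

text \<open>
  The dual matrix is the gradient of the Lagrangian of the primal program in \<open>V\<close>, so the sign of this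
  pairing compares the primal objective with the dual one.
\<close>

lemma inner_dual_lmi:
  "dual_lmi A B C D lam P \<bullet> V
     = primal_objective C D V - lam * input_power V - P \<bullet> stein_defect A B V"
  by (simp add: dual_lmi_def primal_objective_def input_power_def stein_defect_def Re_trace_eq_inner
      inner_congruence inner_add_left inner_diff_left inner_diff_right)

lemma quad_dual_lmi:
  "vjoin a b \<bullet> (dual_lmi A B C D lam P *v vjoin a b) =
     (A *v a + B *v b) \<bullet> (P *v (A *v a + B *v b)) - a \<bullet> (P *v a)
     + (C *v a + D *v b) \<bullet> (C *v a + D *v b) - lam * (b \<bullet> b)"
  unfolding dual_lmi_def
  by (simp add: matrix_vector_mult_add_rdistrib matrix_vector_mult_diff_rdistrib scaleR_mult_vector
      inner_add_right[of "vjoin a b"] inner_diff_right[of "vjoin a b"] inner_congruence_vector hblock_mult_vjoin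
      state_block_vjoin input_block_vjoin del: matrix_mul_rid)

lemma linear_stein_defect: "linear (stein_defect A B)"
  unfolding stein_defect_def[abs_def] by (intro linear_compose_sub linear_congruence)

lemma linear_Re_trace_congruence: "linear (\<lambda>V. Re (trace (W ** V ** ctranspose W)))"
  for W :: "complex^'n^'m"
  unfolding Re_trace_eq_inner
  using linear_compose[OF linear_congruence bounded_linear.linear[OF bounded_linear_inner_right]]
  by (simp add: o_def)

lemma linear_input_power: "linear input_power"
  unfolding input_power_def[abs_def] by (rule linear_Re_trace_congruence)

lemma linear_primal_objective: "linear (primal_objective C D)"
  unfolding primal_objective_def[abs_def] by (rule linear_Re_trace_congruence)

lemma inner_stein_defect_outer:
  "Y \<bullet> stein_defect A B (outer (vjoin a b))
     = a \<bullet> (Y *v a) - (A *v a + B *v b) \<bullet> (Y *v (A *v a + B *v b))"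
  by (simp add: stein_defect_def inner_diff_right inner_congruence inner_outer inner_congruence_vector
      hblock_mult_vjoin state_block_vjoin)

section \<open>Weak duality and dual feasibility\<close>

lemma weak_duality:
  assumes "V \<in> primal_feasible A B" and "(lam, P) \<in> dual_feasible A B C D"
  shows "primal_objective C D V \<le> lam"
proof -
  have "dual_lmi A B C D lam P \<bullet> V \<le> 0"
    using assms by (intro pos_semidef_inner_nonpos_supported[of UNIV])
      (auto simp: primal_feasible_iff dual_feasible_iff neg_semidef_iff)
  moreover have "lam * input_power V \<le> lam"
    using assms by (simp add: primal_feasible_iff dual_feasible_iff mult_left_le)
  ultimately show ?thesis
    using assms(1) by (simp add: inner_dual_lmi primal_feasible_iff)
qed

text \<open>
  Take \<open>P\<close> with \<open>P - A^* P A = C^* C + 1\<close>. Then the upper left block of the dual matrix is \<open>- 1\<close>, and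
  the cross terms \<open>2 Re (a^* M b)\<close>, where \<open>M = A^* P B + C^* D\<close>, are at most \<open>|a|^2 + |M b|^2\<close>. What is left is a quadratic form
  in \<open>b\<close>, which a large multiple of \<open>- |b|^2\<close> makes nonpositive.
\<close>

lemma dual_feasible_nonempty:
  fixes A :: "complex^'n^'n" and B :: "complex^'m^'n"
    and C :: "complex^'n^'l" and D :: "complex^'m^'l"
  assumes "schur_stable A"
  obtains lam P where "(lam, P) \<in> dual_feasible A B C D"
proof -
  have "hermitian (ctranspose C ** C + mat 1)"
    by (simp add: hermitian_def ctranspose_add ctranspose_mult ctranspose_mat_1)
  then obtain P where P: "hermitian P" "P - ctranspose A ** P ** A = ctranspose C ** C + mat 1"
    using stein_equation_solvable[OF assms] by blast
  define M where "M = ctranspose A ** P ** B + ctranspose C ** D"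
  define R where "R = ctranspose B ** P ** B + ctranspose D ** D"
  obtain c where c: "\<And>b. norm (M *v b) \<le> norm b * c"
    using bounded_linear.bounded[OF bounded_linear_mult_vector] by blast
  obtain d where d: "\<And>b. norm (R *v b) \<le> norm b * d"
    using bounded_linear.bounded[OF bounded_linear_mult_vector] by blast
  define lam where "lam = c\<^sup>2 + \<bar>d\<bar>"
  have "vjoin a b \<bullet> (dual_lmi A B C D lam P *v vjoin a b) \<le> 0" for a b
  proof -
    have PA: "(A *v a) \<bullet> (P *v (A *v a)) = a \<bullet> (P *v a) - (C *v a) \<bullet> (C *v a) - a \<bullet> a"
    proof -
      have "a \<bullet> (P *v a) - (A *v a) \<bullet> (P *v (A *v a)) = a \<bullet> ((P - ctranspose A ** P ** A) *v a)"
        by (simp add: matrix_vector_mult_diff_rdistrib inner_diff_right inner_congruence_vector)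
      also have "\<dots> = (C *v a) \<bullet> (C *v a) + a \<bullet> a"
        unfolding P by (simp add: matrix_vector_mult_add_rdistrib inner_add_right inner_ctranspose_mult
            flip: matrix_vector_mul_assoc)
      finally show ?thesis by simp
    qed
    have Mb: "(A *v a) \<bullet> (P *v (B *v b)) + (C *v a) \<bullet> (D *v b) = a \<bullet> (M *v b)"
      by (simp add: M_def matrix_vector_mult_add_rdistrib inner_add_right inner_ctranspose_mult
          flip: matrix_vector_mul_assoc)
    have Rb: "(B *v b) \<bullet> (P *v (B *v b)) + (D *v b) \<bullet> (D *v b) = b \<bullet> (R *v b)"
      by (simp add: R_def matrix_vector_mult_add_rdistrib inner_add_right inner_ctranspose_mult
          flip: matrix_vector_mul_assoc)
    have sym: "(B *v b) \<bullet> (P *v (A *v a)) = (A *v a) \<bullet> (P *v (B *v b))"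
      using inner_hermitian_mult[OF P(1), of "B *v b" "A *v a"] by (simp add: inner_commute)
    have "vjoin a b \<bullet> (dual_lmi A B C D lam P *v vjoin a b)
        = - (a \<bullet> a) + 2 * (a \<bullet> (M *v b)) + b \<bullet> (R *v b) - lam * (b \<bullet> b)"
      unfolding quad_dual_lmi using PA Mb Rb sym
      by (simp add: matrix_vector_right_distrib inner_add_left inner_add_right inner_commute)
    moreover have "2 * (a \<bullet> (M *v b)) \<le> a \<bullet> a + (M *v b) \<bullet> (M *v b)"
      using inner_ge_zero[of "a - M *v b"] by (simp add: inner_diff_left inner_diff_right inner_commute)
    moreover have "(M *v b) \<bullet> (M *v b) \<le> c\<^sup>2 * (b \<bullet> b)"
      using power_mono[OF c[of b], of 2] by (simp add: power_mult_distrib power2_norm_eq_inner mult.commute)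
    moreover have "b \<bullet> (R *v b) \<le> \<bar>d\<bar> * (b \<bullet> b)"
    proof -
      have "b \<bullet> (R *v b) \<le> norm b * norm (R *v b)"
        by (rule norm_cauchy_schwarz)
      also have "\<dots> \<le> norm b * (norm b * \<bar>d\<bar>)"
        by (intro mult_left_mono order_trans[OF d]) auto
      also have "\<dots> = \<bar>d\<bar> * (b \<bullet> b)"
        by (simp add: power2_eq_square flip: power2_norm_eq_inner)
      finally show ?thesis .
    qed
    moreover have "lam * (b \<bullet> b) = c\<^sup>2 * (b \<bullet> b) + \<bar>d\<bar> * (b \<bullet> b)"
      by (simp add: lam_def distrib_right)
    ultimately show ?thesis by linarith
  qed
  then have "x \<bullet> (dual_lmi A B C D lam P *v x) \<le> 0" for x
    by (cases x rule: vjoin_cases) simp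
  then have "(lam, P) \<in> dual_feasible A B C D"
    using P(1) by (simp add: dual_feasible_iff neg_semidef_iff hermitian_dual_lmi lam_def)
  then show thesis by (rule that)
qed

section \<open>Separation and dual attainment\<close>

lemma inner_ctranspose: "ctranspose X \<bullet> ctranspose Y = (X :: complex^'n^'m) \<bullet> Y"
proof -
  have "ctranspose X \<bullet> ctranspose Y = (\<Sum>i\<in>UNIV. \<Sum>j\<in>UNIV. X $ j $ i \<bullet> Y $ j $ i)"
    by (simp add: inner_vec_def ctranspose_def inner_complex_def)
  also have "\<dots> = X \<bullet> Y"
    unfolding inner_vec_def by (rule sum.swap)
  finally show ?thesis .
qed

lemma hermitian_if_orthogonal_to_skew:
  fixes Y :: "complex^'n^'n"
  assumes "\<And>K. ctranspose K = - K \<Longrightarrow> Y \<bullet> K = 0"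
  shows "hermitian Y"
proof -
  define K where "K = ctranspose Y - Y"
  have "Y \<bullet> K = 0"
    by (rule assms) (simp add: K_def ctranspose_diff)
  moreover have "ctranspose Y \<bullet> K = - (Y \<bullet> K)"
    using inner_ctranspose[of Y K]
    by (simp add: K_def ctranspose_diff inner_diff_right)
  ultimately have "K \<bullet> K = 0"
    unfolding K_def by (simp add: inner_diff_left)
  then show ?thesis by (simp add: hermitian_def K_def)
qed

text \<open>
  Consider the triples of constraint violation, unused input power and gain of the objective over
  \<open>p\<close> that positive semidefinite matrices \<open>V\<close> achieve, where power may be wasted (\<open>s\<close>) and the
  gain is reduced by a positive amount (\<open>r\<close>). They form a convex set that misses the origin
  because \<open>p\<close> bounds the primal program, and the normal vector of a separating hyperplane is
  the required multiplier. A skew-Hermitian matrix \<open>K\<close> is added to the first component: this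
  does not bring in the origin, as the constraint violation is Hermitian, and it forces the
  first component of the normal vector to be Hermitian. Without it, that component could be a
  nonzero skew-Hermitian matrix, which carries no information.
\<close>

lemma primal_separation:
  fixes A :: "complex^'n^'n" and B :: "complex^'m^'n"
    and C :: "complex^'n^'l" and D :: "complex^'m^'l"
  assumes bound: "\<And>V. V \<in> primal_feasible A B \<Longrightarrow> primal_objective C D V \<le> p"
  obtains Y mu nu where "(Y, mu, nu) \<noteq> 0" and "hermitian Y" and "0 \<le> mu" and "0 \<le> nu"
    and "\<And>V. pos_semidef V \<Longrightarrow>
      nu * primal_objective C D V + mu * (1 - input_power V) - Y \<bullet> stein_defect A B V \<le> nu * p"
proof -
  define T where "T = {(V :: complex^('n+'m)^('n+'m), K :: complex^'n^'n, s :: real, r :: real).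
    pos_semidef V \<and> ctranspose K = - K \<and> 0 \<le> s \<and> 0 < r}"
  define f where "f = (\<lambda>(V, K, s, r). (stein_defect A B V + K, - input_power V - s, primal_objective C D V - r :: real))"
  have "convex T"
  proof (rule convexI)
    fix x y and u v :: real
    assume xy: "x \<in> T" "y \<in> T" and uv: "0 \<le> u" "0 \<le> v" "u + v = 1"
    obtain V K s r V' K' s' r' where [simp]: "x = (V, K, s, r)" "y = (V', K', s', r')"
      by (metis prod_cases4)
    have "0 < u * r + v * r'"
    proof (cases "u = 0")
      case False
      then show ?thesis using xy uv by (auto simp: T_def intro!: add_pos_nonneg)
    qed (use xy uv in \<open>auto simp: T_def\<close>)
    then show "u *\<^sub>R x + v *\<^sub>R y \<in> T"
      using xy uv
      by (auto simp: T_def ctranspose_add ctranspose_scaleR intro!: pos_semidef_add pos_semidef_scaleR)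
  qed
  moreover have "linear f"
    unfolding f_def
    by (rule linearI)
      (auto simp: linear_add[OF linear_stein_defect] linear_add[OF linear_input_power]
        linear_add[OF linear_primal_objective] linear_scale[OF linear_stein_defect]
        linear_scale[OF linear_input_power] linear_scale[OF linear_primal_objective] algebra_simps)
  ultimately have "convex ((+) (0, 1, - p) ` f ` T)"
    by (intro convex_translation convex_linear_image)
  moreover have "0 \<notin> (+) (0, 1, - p) ` f ` T"
  proof
    assume "0 \<in> (+) (0, 1, - p) ` f ` T"
    then obtain V K s r where *: "pos_semidef V" "ctranspose K = - K" "0 \<le> s" "0 < r"
      "stein_defect A B V + K = 0" "1 - input_power V - s = 0" "primal_objective C D V - r - p = 0"
      by (auto simp: T_def f_def zero_prod_def algebra_simps)
    have "ctranspose (stein_defect A B V) = stein_defect A B V"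
      using *(1) unfolding pos_semidef_iff
      by (simp add: stein_defect_def ctranspose_diff hermitian_congruence[unfolded hermitian_def] hermitian_def)
    moreover have "stein_defect A B V = - K"
      using *(5) by (simp add: eq_neg_iff_add_eq_0)
    ultimately have "K = - K"
      using *(2) by (simp add: ctranspose_minus)
    then have "K $ i $ j = 0" for i j
      using arg_cong[of K "- K" "\<lambda>X. X $ i $ j"] by (simp add: eq_neg_iff_add_eq_0)
    then have "K = 0"
      by (simp add: vec_eq_iff)
    then have "stein_defect A B V = 0"
      using \<open>stein_defect A B V = - K\<close> by simp
    with * have "V \<in> primal_feasible A B"
      by (simp add: primal_feasible_iff)
    from bound[OF this] * show False by simp
  qed
  ultimately obtain a where a: "a \<noteq> 0" "\<And>x. x \<in> (+) (0, 1, - p) ` f ` T \<Longrightarrow> 0 \<le> inner a x"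
    using separating_hyperplane_set_0 by meson
  obtain Y mu nu where a_def: "a = (Y, mu, nu)" by (metis prod_cases3)
  have sep: "0 \<le> Y \<bullet> (stein_defect A B V + K) + mu * (1 - input_power V - s) + nu * (primal_objective C D V - r - p)"
    if "pos_semidef V" "ctranspose K = - K" "0 \<le> s" "0 < r" for V K s r
  proof -
    have "(V, K, s, r) \<in> T" using that by (simp add: T_def)
    then have "0 \<le> inner a ((0, 1, - p) + f (V, K, s, r))"
      by (intro a(2) imageI)
    then show ?thesis
      by (simp add: a_def f_def algebra_simps)
  qed
  note zeros = linear_0[OF linear_stein_defect] linear_0[OF linear_input_power] linear_0[OF linear_primal_objective]
  have "0 \<le> (mu + nu * (-1 - p)) + t * (- mu)" if "0 \<le> t" for t
    using sep[of 0 0 t 1] that by (simp add: zeros pos_semidef_0 ctranspose_0 algebra_simps)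
  from affine_bounded_below_imp_slope_nonneg[OF this] have mu: "mu \<le> 0"
    by simp
  have "0 \<le> (mu + nu * (-1 - p)) + t * (- nu)" if "0 \<le> t" for t
    using sep[of 0 0 0 "1 + t"] that by (simp add: zeros pos_semidef_0 ctranspose_0 algebra_simps)
  from affine_bounded_below_imp_slope_nonneg[OF this] have nu: "nu \<le> 0"
    by simp
  have skew: "0 \<le> Y \<bullet> K" if "ctranspose K = - K" for K
  proof -
    have "0 \<le> (mu + nu * (-1 - p)) + t * (Y \<bullet> K)" if "0 \<le> t" for t
      using sep[of 0 "t *\<^sub>R K" 0 1] \<open>ctranspose K = - K\<close>
      by (simp add: zeros pos_semidef_0 ctranspose_scaleR algebra_simps)
    then show ?thesis
      by (rule affine_bounded_below_imp_slope_nonneg)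
  qed
  have "hermitian Y"
  proof (rule hermitian_if_orthogonal_to_skew)
    fix K :: "complex^'n^'n" assume "ctranspose K = - K"
    with skew[of K] skew[of "- K"] show "Y \<bullet> K = 0"
      by (simp add: ctranspose_minus)
  qed
  \<comment> \<open>Let r tend to 0.\<close>
  have limit: "nu * primal_objective C D V + mu * (1 - input_power V) + Y \<bullet> stein_defect A B V \<ge> nu * p"
    if "pos_semidef V" for V
  proof (rule field_le_epsilon)
    fix e :: real assume "e > 0"
    define r where "r = e / (1 - nu)"
    have "r > 0" using \<open>e > 0\<close> nu by (simp add: r_def)
    have "- nu * r \<le> e"
      using \<open>e > 0\<close> nu by (simp add: r_def field_simps)
    with sep[of V 0 0 r] that \<open>r > 0\<close>
    show "nu * p \<le> nu * primal_objective C D V + mu * (1 - input_power V) + Y \<bullet> stein_defect A B V + e"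
      by (simp add: ctranspose_0 algebra_simps)
  qed
  show thesis
  proof (rule that[of Y "- mu" "- nu"])
    show "(Y, - mu, - nu) \<noteq> 0"
      using a(1) by (auto simp: a_def zero_prod_def)
  qed (use mu nu \<open>hermitian Y\<close> limit in \<open>auto simp: algebra_simps\<close>)
qed

text \<open>
  Dividing the multipliers of the previous lemma by \<open>nu\<close> gives a dual feasible pair: up to the constant
  \<open>lam\<close>, the separation inequality bounds the pairing of the dual matrix with the whole
  positive semidefinite cone. The point is that \<open>nu\<close> is not zero. If it were, then \<open>mu = 0\<close> and \<open>Y\<close>
  would satisfy a Stein inequality whose only solution is \<open>Y = 0\<close>.
\<close>

lemma dual_attains_primal_bound:
  fixes A :: "complex^'n^'n" and B :: "complex^'m^'n"
    and C :: "complex^'n^'l" and D :: "complex^'m^'l"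
  assumes "schur_stable A" and "controllable A B"
    and bound: "\<And>V. V \<in> primal_feasible A B \<Longrightarrow> primal_objective C D V \<le> p"
  obtains lam P where "(lam, P) \<in> dual_feasible A B C D" and "lam \<le> p"
proof -
  obtain Y mu nu where nz: "(Y, mu, nu) \<noteq> 0" and Y: "hermitian Y" and mu: "0 \<le> mu" and nu: "0 \<le> nu"
    and sep: "\<And>V. pos_semidef V \<Longrightarrow>
      nu * primal_objective C D V + mu * (1 - input_power V) - Y \<bullet> stein_defect A B V \<le> nu * p"
    using primal_separation[OF bound] by metis
  note zeros = linear_0[OF linear_stein_defect] linear_0[OF linear_input_power] linear_0[OF linear_primal_objective]
  have mu_le: "mu \<le> nu * p"
    using sep[OF pos_semidef_0] by (simp add: zeros)
  have "nu \<noteq> 0"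
  proof
    assume [simp]: "nu = 0"
    with mu mu_le have [simp]: "mu = 0" by simp
    have "(A *v a + B *v b) \<bullet> (Y *v (A *v a + B *v b)) \<le> a \<bullet> (Y *v a)" for a b
      using sep[OF pos_semidef_outer, of "vjoin a b"] by (simp add: inner_stein_defect_outer)
    then have "Y = 0"
      by (rule stein_inequality_trivial[OF assms(1,2) Y])
    with nz show False by (simp add: zero_prod_def)
  qed
  with nu have nu: "nu > 0" by simp
  define lam where "lam = mu / nu"
  define P where "P = (1 / nu) *\<^sub>R Y"
  have "hermitian P"
    using Y by (simp add: hermitian_def P_def ctranspose_scaleR)
  have "dual_lmi A B C D lam P \<bullet> V \<le> p - lam" if "pos_semidef V" for V
  proof -
    have "nu * (dual_lmi A B C D lam P \<bullet> V + lam)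
      = nu * primal_objective C D V + mu * (1 - input_power V) - Y \<bullet> stein_defect A B V"
      using nu by (simp add: inner_dual_lmi lam_def P_def field_simps)
    also have "\<dots> \<le> nu * p" by (rule sep[OF that])
    finally show ?thesis using nu by simp
  qed
  then have "neg_semidef (dual_lmi A B C D lam P)"
    by (intro neg_semidef_if_bounded_on_cone hermitian_dual_lmi \<open>hermitian P\<close>)
  then have "(lam, P) \<in> dual_feasible A B C D"
    using mu nu \<open>hermitian P\<close> by (simp add: dual_feasible_iff lam_def)
  moreover have "lam \<le> p"
    using mu_le nu by (simp add: lam_def field_simps)
  ultimately show thesis by (rule that)
qed

theorem proposition4:
  fixes A :: "complex^'n^'n" and B :: "complex^'m^'n"
    and C :: "complex^'n^'l" and D :: "complex^'m^'l"
  assumes "schur_stable A" and "controllable A B"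
  shows "strong_duality A B C D"
proof -
  let ?obj = "primal_objective C D" and ?V = "primal_feasible A B"
  obtain lam0 P0 where dual0: "(lam0, P0) \<in> dual_feasible A B C D"
    using dual_feasible_nonempty[OF assms(1)] by blast
  have "0 \<in> ?V"
    by (simp add: primal_feasible_iff pos_semidef_0 linear_0[OF linear_stein_defect] linear_0[OF linear_input_power])
  then have "0 \<le> primal_value A B C D"
    unfolding primal_value_def
    by (intro SUP_upper2[of 0]) (auto simp: linear_0[OF linear_primal_objective])
  moreover have "primal_value A B C D \<le> ereal lam0"
    unfolding primal_value_def by (intro SUP_least) (use weak_duality[OF _ dual0] in auto)
  ultimately obtain p where p: "primal_value A B C D = ereal p"
    by (cases "primal_value A B C D") auto
  have "?obj V \<le> p" if "V \<in> ?V" for V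
    using SUP_upper[OF that, of "\<lambda>V. ereal (?obj V)"] p by (simp add: primal_value_def)
  then obtain lam P where dual: "(lam, P) \<in> dual_feasible A B C D" and "lam \<le> p"
    using dual_attains_primal_bound[OF assms] by blast
  from \<open>lam \<le> p\<close> have "ereal lam \<le> primal_value A B C D"
    by (simp add: p)
  moreover have "primal_value A B C D \<le> dual_value A B C D"
    unfolding primal_value_def dual_value_def
    by (intro SUP_least INF_greatest) (auto dest: weak_duality)
  moreover have "dual_value A B C D \<le> ereal lam"
    unfolding dual_value_def using INF_lower[OF dual, of "\<lambda>(lam, P). ereal lam"] by simp
  ultimately have "primal_value A B C D = dual_value A B C D" "ereal lam = dual_value A B C D"
    by auto
  with dual show ?thesis
    unfolding strong_duality_def by (auto intro!: bexI[of _ "(lam, P)"])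
qed

end
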